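(* Let $a=(a_0,a_1,\ldots)$, $b=(b_0,b_1,\ldots)\in\mathbf W(\mathbb F_2)$ and write, in $\mathbf W(\mathbb F_2)$, $a\dot+b=(c_0,c_1,\ldots)$, $\dot-a=(d_0,d_1,\ldots)$, $a\dot\times b=(e_0,e_1,\ldots)$. Then in $\mathbb F_2$: (i) $c_0=a_0+b_0$ and for $t\ge1$, $c_t=a_t+b_t+\sum_{i=0}^{t-1}a_ib_i\prod_{j=i+1}^{t-1}(a_j+b_j)$; (ii) $d_0=a_0$ and for $t\ge1$, $d_t=a_t+1+\prod_{i=0}^{t-1}(1+a_i)$; (iii) $e_0=a_0b_0$ and for $t\ge1$, $e_t=\sum_{(l_1,\ldots,l_t)\in\mathbf L_2(t)}\prod_{1\le k\le t}\tau_{l_k}(a_0b_k,a_1b_{k-1},\ldots,a_kb_0)$.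
   Context: $\mathbf W(\mathbb F_2)$ is the ring of ($2$-typical) Witt vectors with coefficients in $\mathbb F_2$, with Witt addition $\dot+$, negation $\dot-$ and multiplication $\dot\times$. $\mathbf L_2(t)=\{(l_1,\ldots,l_t)\in\mathbb Z_{\ge0}^t:\sum_{k=1}^t l_k2^k=2^t,\ 0\le l_k\le k+1\}$. $\tau_l(X_0,\ldots,X_m)$ denotes the $l$-th elementary symmetric polynomial in $X_0,\ldots,X_m$ ($\tau_0=1$). Empty products equal $1$. *)

theory Defs
  imports "HOL-Library.Poly_Mapping" "HOL-Library.Z2" "HOL-Library.FuncSet"
    "HOL-Number_Theory.Number_Theory"
begin

section \<open>Integral polynomials in arbitrarily many variables\<close>

text \<open>A monomial is a finitely supported exponent function, a polynomial a finitely supported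
  coefficient function on monomials; multiplication is the convolution product.\<close>

type_synonym 'v ipoly = "('v \<Rightarrow>\<^sub>0 nat) \<Rightarrow>\<^sub>0 int"

definition ivar :: "'v \<Rightarrow> 'v ipoly" where
  "ivar v = Poly_Mapping.single (Poly_Mapping.single v 1) 1"

definition meval :: "('v \<Rightarrow> 'a::comm_ring_1) \<Rightarrow> ('v \<Rightarrow>\<^sub>0 nat) \<Rightarrow> 'a" where
  "meval f m = (\<Prod>v\<in>Poly_Mapping.keys m. f v ^ Poly_Mapping.lookup m v)"

definition ieval :: "('v \<Rightarrow> 'a::comm_ring_1) \<Rightarrow> 'v ipoly \<Rightarrow> 'a" where
  "ieval f P = (\<Sum>m\<in>Poly_Mapping.keys P. of_int (Poly_Mapping.lookup P m) * meval f m)"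

section \<open>Witt vectors\<close>

definition ghost :: "nat \<Rightarrow> (nat \<Rightarrow> 'a::comm_ring_1) \<Rightarrow> nat \<Rightarrow> 'a" where
  "ghost p x n = (\<Sum>i\<le>n. of_nat p ^ i * x i ^ (p ^ (n - i)))"

text \<open>The structure polynomials of the \<open>p\<close>-typical Witt vectors: the unique families of integral
  polynomials that make the ghost components additive, negation preserving and multiplicative.
  Existence and uniqueness for prime \<open>p\<close> are proved below.  The variables \<open>X\<^sub>i\<close> and \<open>Y\<^sub>i\<close> are indexed
  by \<open>Inl i\<close> and \<open>Inr i\<close>.\<close>

definition witt_add_poly :: "nat \<Rightarrow> nat \<Rightarrow> (nat + nat) ipoly" where
  "witt_add_poly p = (THE S. \<forall>n. ghost p S n =
     ghost p (\<lambda>i. ivar (Inl i)) n + ghost p (\<lambda>i. ivar (Inr i)) n)"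

definition witt_neg_poly :: "nat \<Rightarrow> nat \<Rightarrow> nat ipoly" where
  "witt_neg_poly p = (THE S. \<forall>n. ghost p S n = - ghost p ivar n)"

definition witt_mult_poly :: "nat \<Rightarrow> nat \<Rightarrow> (nat + nat) ipoly" where
  "witt_mult_poly p = (THE S. \<forall>n. ghost p S n =
     ghost p (\<lambda>i. ivar (Inl i)) n * ghost p (\<lambda>i. ivar (Inr i)) n)"

text \<open>A Witt vector over a commutative ring is the sequence of its components.\<close>

definition witt_add :: "nat \<Rightarrow> (nat \<Rightarrow> 'a::comm_ring_1) \<Rightarrow> (nat \<Rightarrow> 'a) \<Rightarrow> nat \<Rightarrow> 'a" where
  "witt_add p a b n = ieval (case_sum a b) (witt_add_poly p n)"

definition witt_neg :: "nat \<Rightarrow> (nat \<Rightarrow> 'a::comm_ring_1) \<Rightarrow> nat \<Rightarrow> 'a" where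
  "witt_neg p a n = ieval a (witt_neg_poly p n)"

definition witt_mult :: "nat \<Rightarrow> (nat \<Rightarrow> 'a::comm_ring_1) \<Rightarrow> (nat \<Rightarrow> 'a) \<Rightarrow> nat \<Rightarrow> 'a" where
  "witt_mult p a b n = ieval (case_sum a b) (witt_mult_poly p n)"

section \<open>Index set and elementary symmetric polynomials\<close>

definition L2 :: "nat \<Rightarrow> (nat \<Rightarrow> nat) set" where
  "L2 t = {l \<in> {1..t} \<rightarrow>\<^sub>E UNIV. (\<Sum>k=1..t. l k * 2 ^ k) = 2 ^ t \<and> (\<forall>k\<in>{1..t}. l k \<le> k + 1)}"

text \<open>\<open>esym l m x\<close> is the value of the \<open>l\<close>-th elementary symmetric polynomial at the \<open>m + 1\<close>
  arguments \<open>x 0, \<dots>, x m\<close>.\<close>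

definition esym :: "nat \<Rightarrow> nat \<Rightarrow> (nat \<Rightarrow> 'a::comm_ring_1) \<Rightarrow> 'a" where
  "esym l m x = (\<Sum>S | S \<subseteq> {0..m} \<and> card S = l. \<Prod>i\<in>S. x i)"

lemma finite_L2: "finite (L2 t)"
proof (rule finite_subset)
  show "L2 t \<subseteq> {1..t} \<rightarrow>\<^sub>E {..t + 1}"
    by (force simp: L2_def PiE_def Pi_def)
  show "finite ({1..t} \<rightarrow>\<^sub>E {..t + 1})"
    by (intro finite_PiE) auto
qed

section \<open>Evaluation is a ring homomorphism\<close>

lemma meval_superset:
  assumes "finite A" "Poly_Mapping.keys m \<subseteq> A"
  shows "meval f m = (\<Prod>v\<in>A. f v ^ Poly_Mapping.lookup m v)"
  unfolding meval_def using assms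
  by (intro prod.mono_neutral_left) (auto simp: in_keys_iff)

lemma meval_0 [simp]: "meval f 0 = 1"
  by (simp add: meval_def)

lemma meval_add: "meval f (m + n) = meval f m * meval f n"
proof -
  let ?A = "Poly_Mapping.keys m \<union> Poly_Mapping.keys n"
  have "Poly_Mapping.keys (m + n) \<subseteq> ?A"
    by (rule keys_add)
  then show ?thesis
    by (simp add: meval_superset[of ?A] lookup_add power_add prod.distrib)
qed

lemma ieval_superset:
  assumes "finite A" "Poly_Mapping.keys P \<subseteq> A"
  shows "ieval f P = (\<Sum>m\<in>A. of_int (Poly_Mapping.lookup P m) * meval f m)"
  unfolding ieval_def using assms
  by (intro sum.mono_neutral_left) (auto simp: in_keys_iff)

lemma ieval_add: "ieval f (P + Q) = ieval f P + ieval f Q"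
proof -
  let ?A = "Poly_Mapping.keys P \<union> Poly_Mapping.keys Q"
  have "Poly_Mapping.keys (P + Q) \<subseteq> ?A"
    by (rule keys_add)
  then show ?thesis
    by (simp add: ieval_superset[of ?A] lookup_add algebra_simps sum.distrib)
qed

lemma ieval_single: "ieval f (Poly_Mapping.single m c) = of_int c * meval f m"
  by (simp add: ieval_def)

lemma ieval_0 [simp]: "ieval f 0 = 0"
  by (simp add: ieval_def)

lemma ieval_1 [simp]: "ieval f 1 = 1"
  using ieval_single[of f 0 1] by simp

lemma ieval_ivar [simp]: "ieval f (ivar v) = f v"
  by (simp add: ivar_def ieval_single meval_def)

lemma ipoly_induct [case_names single add]:
  fixes P :: "'v ipoly"
  assumes single: "\<And>m c. \<Phi> (Poly_Mapping.single m c)"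
    and add: "\<And>P Q. \<Phi> P \<Longrightarrow> \<Phi> Q \<Longrightarrow> \<Phi> (P + Q)"
  shows "\<Phi> P"
proof (induction P rule: update_induct)
  case const
  show ?case using single[of 0 0] by simp
next
  case (update P m c)
  have "Poly_Mapping.update m c P = Poly_Mapping.single m c + P"
    using update by (intro poly_mapping_eqI)
      (auto simp: lookup_update lookup_add lookup_single in_keys_iff when_def)
  then show ?case using add[OF single update(3)] by simp
qed

lemma ieval_mult: "ieval f (P * Q) = ieval f P * ieval f Q"
proof (induction P rule: ipoly_induct)
  case (single m c)
  show ?case
  proof (induction Q rule: ipoly_induct)
    case (single n d)
    show ?case by (simp add: mult_single ieval_single meval_add algebra_simps)
  qed (simp add: algebra_simps ieval_add)
qed (simp add: algebra_simps ieval_add)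

lemma ieval_uminus: "ieval f (- P) = - ieval f P"
  by (metis add_eq_0_iff ieval_0 ieval_add add.right_inverse)

lemma ieval_power: "ieval f (P ^ n) = ieval f P ^ n"
  by (induction n) (simp_all add: ieval_mult)

lemma ieval_of_nat: "ieval f (of_nat n) = of_nat n"
  by (induction n) (simp_all add: ieval_add)

lemma ieval_sum: "ieval f (sum g A) = (\<Sum>i\<in>A. ieval f (g i))"
  by (induction A rule: infinite_finite_induct) (simp_all add: ieval_add)

lemma ieval_ghost: "ieval f (ghost p x n) = ghost p (\<lambda>i. ieval f (x i)) n"
  by (simp add: ghost_def ieval_sum ieval_mult ieval_power ieval_of_nat)

section \<open>Existence and uniqueness of the structure polynomials\<close>

lemma lookup_of_nat_mult:
  fixes P :: "'v ipoly"
  shows "Poly_Mapping.lookup (of_nat n * P) m = int n * Poly_Mapping.lookup P m"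
  by (induction n) (simp_all add: algebra_simps lookup_add)

lemma of_nat_mult_cancel:
  fixes P Q :: "'v ipoly"
  assumes "of_nat n * P = of_nat n * Q" "n > 0"
  shows "P = Q"
proof (rule poly_mapping_eqI)
  fix m
  have "int n * Poly_Mapping.lookup P m = int n * Poly_Mapping.lookup Q m"
    using assms(1) by (metis lookup_of_nat_mult)
  then show "Poly_Mapping.lookup P m = Poly_Mapping.lookup Q m"
    using assms(2) by simp
qed

lemma ghost_inj:
  fixes S T :: "nat \<Rightarrow> 'v ipoly"
  assumes "p > 0" "\<And>n. ghost p S n = ghost p T n"
  shows "S = T"
proof
  fix n show "S n = T n"
  proof (induction n rule: less_induct)
    case (less n)
    have *: "ghost p U n = (\<Sum>i<n. of_nat p ^ i * U i ^ (p ^ (n - i))) + of_nat (p ^ n) * U n"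
      for U :: "nat \<Rightarrow> 'v ipoly"
      by (simp add: ghost_def flip: lessThan_Suc_atMost)
    have "(\<Sum>i<n. of_nat p ^ i * S i ^ (p ^ (n - i))) = (\<Sum>i<n. of_nat p ^ i * T i ^ (p ^ (n - i)))"
      using less by (intro sum.cong) auto
    then have "of_nat (p ^ n) * S n = of_nat (p ^ n) * T n"
      using assms(2)[of n] unfolding * by simp
    then show ?case
      by (rule of_nat_mult_cancel) (use assms(1) in simp)
  qed
qed

lemma dvd_power_add_diff:
  fixes x y :: "'a::comm_ring_1"
  assumes "prime p"
  shows "of_nat p dvd (x + y) ^ p - (x ^ p + y ^ p)"
proof -
  have p: "p > 0" using assms by (simp add: prime_gt_0_nat)
  have set: "{..p} = insert 0 (insert p {0<..<p})" using p by auto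
  have "(x + y) ^ p = x ^ p + y ^ p + (\<Sum>k\<in>{0<..<p}. of_nat (p choose k) * x ^ k * y ^ (p - k))"
    unfolding binomial_ring set using p by simp
  moreover have "of_nat p dvd (\<Sum>k\<in>{0<..<p}. of_nat (p choose k) * x ^ k * y ^ (p - k))"
  proof (rule dvd_sum)
    fix k assume "k \<in> {0<..<p}"
    then have "p dvd (p choose k)"
      using assms by (intro dvd_choose_prime) auto
    then have "(of_nat p :: 'a) dvd of_nat (p choose k)"
      by (metis dvd_def of_nat_mult)
    then show "(of_nat p :: 'a) dvd of_nat (p choose k) * x ^ k * y ^ (p - k)"
      by (simp add: dvd_mult2)
  qed
  ultimately show ?thesis by simp
qed

lemma dvd_power_diff_step:
  fixes x y :: "'a::comm_ring_1"
  assumes "of_nat p ^ k dvd x - y" "k > 0"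
  shows "of_nat p ^ Suc k dvd x ^ p - y ^ p"
proof -
  obtain d where d: "x = y + of_nat p ^ k * d"
    using assms(1) by (metis dvdE diff_add_cancel add.commute)
  have p_dvd: "of_nat p dvd x - y"
    using assms by (metis dvd_power dvd_trans)
  have "of_nat p dvd (\<Sum>i<p. y ^ (p - Suc i) * x ^ i - y ^ (p - Suc i) * y ^ i)"
  proof (rule dvd_sum)
    fix i
    have "x - y dvd x ^ i - y ^ i"
      by (cases i) (simp_all add: power_diff_sumr2 del: power_Suc)
    then show "of_nat p dvd y ^ (p - Suc i) * x ^ i - y ^ (p - Suc i) * y ^ i"
      using p_dvd by (metis dvd_mult dvd_trans right_diff_distrib)
  qed
  moreover have "(\<Sum>i<p. y ^ (p - Suc i) * y ^ i) = of_nat p * y ^ (p - 1)"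
  proof -
    have "(\<Sum>i<p. y ^ (p - Suc i) * y ^ i) = (\<Sum>i<p. y ^ (p - 1))"
      by (intro sum.cong) (auto simp flip: power_add)
    then show ?thesis by simp
  qed
  ultimately have "of_nat p dvd (\<Sum>i<p. y ^ (p - Suc i) * x ^ i)"
    by (simp add: sum_subtractf dvd_diff_left_iff)
  then have "of_nat p ^ k * of_nat p dvd (x - y) * (\<Sum>i<p. y ^ (p - Suc i) * x ^ i)"
    by (intro mult_dvd_mono assms)
  then show ?thesis
    by (simp add: power_diff_sumr2 mult.commute)
qed

lemma dvd_power_diff_iter:
  fixes x y :: "'a::comm_ring_1"
  assumes "of_nat p dvd x - y"
  shows "of_nat p ^ Suc k dvd x ^ (p ^ k) - y ^ (p ^ k)"
proof (induction k)
  case (Suc k)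
  then show ?case
    using dvd_power_diff_step[OF Suc] by (simp add: power_mult mult.commute flip: power_mult)
qed (use assms in simp)

lemma int_power_cong:
  fixes c :: int
  assumes "prime p"
  shows "[c ^ p = c] (mod int p)"
proof -
  have nat: "[int n ^ p = int n] (mod int p)" for n
  proof (induction n)
    case 0
    show ?case using prime_gt_0_nat[OF assms] by (simp add: zero_power)
  next
    case (Suc n)
    have "[(int n + 1) ^ p = int n ^ p + 1 ^ p] (mod int p)"
      using dvd_power_add_diff[OF assms, of "int n" 1] by (simp add: cong_iff_dvd_diff)
    also have "[int n ^ p + 1 ^ p = int n + 1] (mod int p)"
      using Suc by (simp add: cong_add_rcancel)
    finally show ?case by (simp add: add.commute)
  qed
  define n where "n = nat (c mod int p)"
  have "int n = c mod int p"
    using assms by (simp add: n_def prime_gt_0_nat)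
  then have n: "[c = int n] (mod int p)"
    by (simp add: cong_def)
  then have "[c ^ p = int n ^ p] (mod int p)" by (rule cong_pow)
  also note nat
  also have "[int n = c] (mod int p)" using n by (rule cong_sym)
  finally show ?thesis .
qed

definition frob :: "nat \<Rightarrow> 'v ipoly \<Rightarrow> 'v ipoly" where
  "frob p = ieval (\<lambda>v. ivar v ^ p)"

lemma single_monomial:
  fixes m :: "'v \<Rightarrow>\<^sub>0 nat"
  shows "Poly_Mapping.single m 1 = (meval ivar m :: 'v ipoly)"
proof (induction m rule: update_induct)
  case (update m v k)
  have eq: "Poly_Mapping.update v k m = Poly_Mapping.single v k + m"
    using update by (intro poly_mapping_eqI)
      (auto simp: lookup_update lookup_add lookup_single in_keys_iff when_def)
  have pow: "Poly_Mapping.single (Poly_Mapping.single v k) 1 = (ivar v ^ k :: 'v ipoly)"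
  proof (induction k)
    case (Suc k)
    have "Poly_Mapping.single (Poly_Mapping.single v (Suc k)) (1::int)
        = ivar v * Poly_Mapping.single (Poly_Mapping.single v k) 1"
      by (simp add: ivar_def mult_single flip: single_add)
    then show ?case using Suc by simp
  qed simp
  have "Poly_Mapping.single (Poly_Mapping.update v k m) (1::int)
     = Poly_Mapping.single (Poly_Mapping.single v k) 1 * Poly_Mapping.single m 1"
    by (simp add: eq mult_single)
  also have "\<dots> = meval ivar (Poly_Mapping.single v k) * meval ivar m"
    using update(3) pow by (simp add: meval_def)
  finally show ?case by (simp add: eq meval_add)
qed simp

lemma frob_cong:
  fixes P :: "'v ipoly"
  assumes "prime p"
  shows "of_nat p dvd frob p P - P ^ p"
proof (induction P rule: ipoly_induct)
  case (single m c)
  have c: "Poly_Mapping.single m c = of_int c * (meval ivar m :: 'v ipoly)"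
    by (simp add: mult_single flip: single_monomial single_of_int)
  have "frob p (Poly_Mapping.single m c) = of_int c * meval ivar m ^ p"
    by (simp add: frob_def ieval_single meval_def prod_power_distrib mult.commute flip: power_mult)
  then have "frob p (Poly_Mapping.single m c) - Poly_Mapping.single m c ^ p
      = of_int (c - c ^ p) * meval ivar m ^ p"
    by (simp add: c power_mult_distrib algebra_simps)
  moreover have "int p dvd c - c ^ p"
    using int_power_cong[OF assms, of c] by (simp add: cong_iff_dvd_diff dvd_diff_commute)
  then have "(of_nat p :: 'v ipoly) dvd of_int (c - c ^ p)"
    by (metis dvd_def of_int_mult of_int_of_nat_eq)
  ultimately show ?case by (simp only: dvd_mult2)
next
  case (add P Q)
  have "frob p (P + Q) - (P + Q) ^ p
     = (frob p P - P ^ p) + (frob p Q - Q ^ p) - ((P + Q) ^ p - (P ^ p + Q ^ p))"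
    by (simp add: frob_def ieval_add)
  then show ?case
    using add dvd_power_add_diff[OF assms, of P Q] by (simp only: dvd_add dvd_diff)
qed

lemma ghost_surj:
  fixes w :: "nat \<Rightarrow> 'v ipoly"
  assumes "prime p" and w: "\<And>n. of_nat p ^ Suc n dvd w (Suc n) - frob p (w n)"
  shows "\<exists>S. \<forall>n. ghost p S n = w n"
proof -
  define \<Phi> :: "(nat \<Rightarrow> 'v ipoly) \<Rightarrow> nat \<Rightarrow> 'v ipoly \<Rightarrow> bool" where
    "\<Phi> = (\<lambda>f n r. w n = (\<Sum>i<n. of_nat p ^ i * f i ^ (p ^ (n - i))) + of_nat p ^ n * r)"
  have "\<exists>f. \<forall>n. \<Phi> f n (f n)"
  proof (rule dependent_wf_choice[of less_than])
    fix f g :: "nat \<Rightarrow> 'v ipoly" and n r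
    assume "\<And>z. (z, n) \<in> less_than \<Longrightarrow> f z = g z"
    then have "(\<Sum>i<n. of_nat p ^ i * f i ^ (p ^ (n - i))) = (\<Sum>i<n. of_nat p ^ i * g i ^ (p ^ (n - i)))"
      by (intro sum.cong) auto
    then show "\<Phi> f n r = \<Phi> g n r" by (simp add: \<Phi>_def)
  next
    fix n and f :: "nat \<Rightarrow> 'v ipoly"
    assume IH: "\<And>y. (y, n) \<in> less_than \<Longrightarrow> \<Phi> f y (f y)"
    show "\<exists>r. \<Phi> f n r"
    proof (cases n)
      case 0
      then show ?thesis by (simp add: \<Phi>_def)
    next
      case (Suc m)
      have "w m = ghost p f m"
        using IH[of m] Suc by (simp add: \<Phi>_def ghost_def flip: lessThan_Suc_atMost)
      then have fw: "frob p (w m) = (\<Sum>i\<le>m. of_nat p ^ i * frob p (f i) ^ (p ^ (m - i)))"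
        by (simp add: frob_def ieval_ghost) (simp add: ghost_def)
      have "of_nat p ^ Suc m dvd (\<Sum>i\<le>m. of_nat p ^ i * frob p (f i) ^ (p ^ (m - i))
          - of_nat p ^ i * f i ^ (p ^ (Suc m - i)))"
      proof (rule dvd_sum)
        fix i assume "i \<in> {..m}"
        then have i: "i \<le> m" by simp
        have "of_nat p ^ Suc (m - i) dvd frob p (f i) ^ (p ^ (m - i)) - (f i ^ p) ^ (p ^ (m - i))"
          by (intro dvd_power_diff_iter frob_cong assms)
        moreover have "(f i ^ p) ^ (p ^ (m - i)) = f i ^ (p ^ (Suc m - i))"
          using i by (simp add: Suc_diff_le flip: power_mult)
        ultimately have "of_nat p ^ i * of_nat p ^ Suc (m - i) dvd
            of_nat p ^ i * (frob p (f i) ^ (p ^ (m - i)) - f i ^ (p ^ (Suc m - i)))"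
          by (intro mult_dvd_mono) auto
        moreover have "(of_nat p :: 'v ipoly) ^ i * of_nat p ^ Suc (m - i) = of_nat p ^ Suc m"
          using i by (simp flip: power_add power_Suc)
        ultimately show "of_nat p ^ Suc m dvd of_nat p ^ i * frob p (f i) ^ (p ^ (m - i))
          - of_nat p ^ i * f i ^ (p ^ (Suc m - i))"
          by (simp only: right_diff_distrib)
      qed
      then have "of_nat p ^ Suc m dvd
          frob p (w m) - (\<Sum>i\<le>m. of_nat p ^ i * f i ^ (p ^ (Suc m - i)))"
        by (simp only: fw sum_subtractf)
      from dvd_add[OF w[of m] this]
      have "of_nat p ^ n dvd w n - (\<Sum>i<n. of_nat p ^ i * f i ^ (p ^ (n - i)))"
        by (simp add: Suc lessThan_Suc_atMost)
      then obtain r where "w n - (\<Sum>i<n. of_nat p ^ i * f i ^ (p ^ (n - i))) = of_nat p ^ n * r"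
        by (elim dvdE)
      then show ?thesis
        by (intro exI[of _ r]) (simp add: \<Phi>_def algebra_simps)
    qed
  qed simp
  then obtain S where S: "\<And>n. \<Phi> S n (S n)" by blast
  have "ghost p S n = w n" for n
    using S[of n] by (simp add: \<Phi>_def ghost_def flip: lessThan_Suc_atMost)
  then show ?thesis by blast
qed

lemma ghost_ex1:
  fixes w :: "nat \<Rightarrow> 'v ipoly"
  assumes "prime p" "\<And>n. of_nat p ^ Suc n dvd w (Suc n) - frob p (w n)"
  shows "\<exists>!S. \<forall>n. ghost p S n = w n"
proof (rule ex_ex1I)
  show "\<exists>S. \<forall>n. ghost p S n = w n" by (rule ghost_surj[OF assms])
  show "S = T" if "\<forall>n. ghost p S n = w n" "\<forall>n. ghost p T n = w n" for S T
    using that assms(1) by (intro ghost_inj[of p]) (simp_all add: prime_gt_0_nat)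
qed

lemma frob_ghost_ivar:
  "of_nat p ^ Suc n dvd ghost p (\<lambda>i. ivar (h i)) (Suc n) - frob p (ghost p (\<lambda>i. ivar (h i)) n)"
proof -
  have "frob p (ghost p (\<lambda>i. ivar (h i)) n) = (\<Sum>i\<le>n. of_nat p ^ i * (ivar (h i) ^ p) ^ (p ^ (n - i)))"
    by (simp add: frob_def ieval_ghost) (simp add: ghost_def)
  also have "\<dots> = (\<Sum>i\<le>n. of_nat p ^ i * ivar (h i) ^ (p ^ (Suc n - i)))"
    by (intro sum.cong) (auto simp: Suc_diff_le simp flip: power_mult)
  finally show ?thesis by (simp add: ghost_def)
qed

lemma witt_add_poly_ex1:
  assumes "prime p"
  shows "\<exists>!S. \<forall>n. ghost p S n =
    ghost p (\<lambda>i. ivar (Inl i)) n + ghost p (\<lambda>i. ivar (Inr i) :: (nat + nat) ipoly) n"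
proof (rule ghost_ex1[OF assms])
  fix n
  show "of_nat p ^ Suc n dvd ghost p (\<lambda>i. ivar (Inl i)) (Suc n) + ghost p (\<lambda>i. ivar (Inr i)) (Suc n)
    - frob p (ghost p (\<lambda>i. ivar (Inl i)) n + ghost p (\<lambda>i. ivar (Inr i) :: (nat + nat) ipoly) n)"
    using dvd_add[OF frob_ghost_ivar[of p n Inl] frob_ghost_ivar[of p n Inr]]
    by (simp add: frob_def ieval_add algebra_simps)
qed

lemma witt_neg_poly_ex1:
  assumes "prime p"
  shows "\<exists>!S. \<forall>n. ghost p S n = - ghost p (ivar :: nat \<Rightarrow> nat ipoly) n"
proof (rule ghost_ex1[OF assms])
  fix n
  have "- (ghost p ivar (Suc n)) - frob p (- ghost p (ivar :: nat \<Rightarrow> nat ipoly) n)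
      = - (ghost p ivar (Suc n) - frob p (ghost p ivar n))"
    by (simp add: frob_def ieval_uminus)
  then show "of_nat p ^ Suc n dvd - ghost p ivar (Suc n) - frob p (- ghost p (ivar :: nat \<Rightarrow> nat ipoly) n)"
    using frob_ghost_ivar[of p n "\<lambda>i::nat. i"] by (simp only: dvd_minus_iff)
qed

lemma witt_mult_poly_ex1:
  assumes "prime p"
  shows "\<exists>!S. \<forall>n. ghost p S n =
    ghost p (\<lambda>i. ivar (Inl i)) n * ghost p (\<lambda>i. ivar (Inr i) :: (nat + nat) ipoly) n"
proof (rule ghost_ex1[OF assms])
  fix n
  let ?X = "ghost p (\<lambda>i. ivar (Inl i) :: (nat + nat) ipoly)"
  let ?Y = "ghost p (\<lambda>i. ivar (Inr i) :: (nat + nat) ipoly)"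
  have "?X (Suc n) * ?Y (Suc n) - frob p (?X n * ?Y n)
     = (?X (Suc n) - frob p (?X n)) * ?Y (Suc n) + frob p (?X n) * (?Y (Suc n) - frob p (?Y n))"
    by (simp add: frob_def ieval_mult algebra_simps)
  then show "of_nat p ^ Suc n dvd ?X (Suc n) * ?Y (Suc n) - frob p (?X n * ?Y n)"
    using dvd_add[OF dvd_mult2[OF frob_ghost_ivar[of p n Inl], of "?Y (Suc n)"]
        dvd_mult[OF frob_ghost_ivar[of p n Inr], of "frob p (?X n)"]]
    by simp
qed

lemma ghost_witt_add_poly:
  assumes "prime p"
  shows "ghost p (witt_add_poly p) n = ghost p (\<lambda>i. ivar (Inl i)) n + ghost p (\<lambda>i. ivar (Inr i)) n"
  using theI'[OF witt_add_poly_ex1[OF assms]] by (simp add: witt_add_poly_def)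

lemma ghost_witt_neg_poly:
  assumes "prime p"
  shows "ghost p (witt_neg_poly p) n = - ghost p ivar n"
  using theI'[OF witt_neg_poly_ex1[OF assms]] by (simp add: witt_neg_poly_def)

lemma ghost_witt_mult_poly:
  assumes "prime p"
  shows "ghost p (witt_mult_poly p) n = ghost p (\<lambda>i. ivar (Inl i)) n * ghost p (\<lambda>i. ivar (Inr i)) n"
  using theI'[OF witt_mult_poly_ex1[OF assms]] by (simp add: witt_mult_poly_def)

lemma ghost_witt_add:
  assumes "prime p"
  shows "ghost p (witt_add p a b) n = ghost p a n + ghost p b n"
proof -
  have "ghost p (witt_add p a b) n = ieval (case_sum a b) (ghost p (witt_add_poly p) n)"
    by (simp add: ieval_ghost witt_add_def[abs_def])
  then show ?thesis
    by (simp add: ghost_witt_add_poly[OF assms] ieval_add ieval_ghost)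
qed

lemma ghost_witt_neg:
  assumes "prime p"
  shows "ghost p (witt_neg p a) n = - ghost p a n"
proof -
  have "ghost p (witt_neg p a) n = ieval a (ghost p (witt_neg_poly p) n)"
    by (simp add: ieval_ghost witt_neg_def[abs_def])
  then show ?thesis
    by (simp add: ghost_witt_neg_poly[OF assms] ieval_uminus ieval_ghost)
qed

lemma ghost_witt_mult:
  assumes "prime p"
  shows "ghost p (witt_mult p a b) n = ghost p a n * ghost p b n"
proof -
  have "ghost p (witt_mult p a b) n = ieval (case_sum a b) (ghost p (witt_mult_poly p) n)"
    by (simp add: ieval_ghost witt_mult_def[abs_def])
  then show ?thesis
    by (simp add: ghost_witt_mult_poly[OF assms] ieval_mult ieval_ghost)
qed

end

theory Submission
  imports Defs "HOL-Computational_Algebra.Polynomial"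
begin

text \<open>Lift the components of \<open>a\<close> and \<open>b\<close> to integers in \<open>{0, 1}\<close>. The \<open>n\<close>-th ghost component of such
  a vector is the integer with binary digits \<open>a\<^sub>0, \<dots>, a\<^sub>n\<close>, and for an arbitrary integral vector \<open>x\<close>
  the \<open>n\<close>-th ghost component modulo \<open>2 ^ (n + 1)\<close> depends only on the parities of the \<open>x\<^sub>i\<close>. So the
  Witt operations over the field with two elements are binary arithmetic modulo \<open>2 ^ (n + 1)\<close>. The
  formula for the sum is carry propagation, and the one for the negative is complement plus one.
  For the product, digit \<open>t\<close> of \<open>N\<close> is the coefficient of \<open>z ^ (2 ^ t)\<close> in \<open>(1 + z) ^ N\<close> modulo 2;
  with \<open>N\<close> the sum of all \<open>2 ^ k * a\<^sub>i * b\<^sub>k\<^sub>-\<^sub>i\<close> with \<open>k \<le> t\<close>, this power is the product of the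
  \<open>1 + a\<^sub>i * b\<^sub>k\<^sub>-\<^sub>i * z ^ (2 ^ k)\<close>, whose expansion gives the elementary symmetric polynomials.\<close>

(* These rules would rewrite sums and products of bits to xor and and, out of reach of ring lemmas. *)
declare add_bit_eq_xor [simp del] mult_bit_eq_and [simp del]

section \<open>Passage from integers to the field with two elements\<close>

text \<open>Integral coefficients are what lets the Witt operations be computed over
  \<open>int\<close>, where ghost components determine a vector, and then reduced to
  \<open>bit\<close>, where they do not.\<close>

lemma ieval_of_int:
  "ieval (\<lambda>v. of_int (f v)) P = (of_int (ieval f P) :: 'a::comm_ring_1)"
  by (simp add: ieval_def meval_def)

lemma of_int_bit: "of_int k = (of_bool (odd k) :: bit)"
  by (metis (full_types) Z2.bit_eq_iff even_of_int_iff odd_of_bool_self of_bool_eq(1) even_zero odd_one)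

lemma of_int_of_bit: "of_int (of_bit x) = (x :: bit)"
  by (cases x) simp_all

lemma witt_add_of_int:
  "witt_add p (\<lambda>i. of_int (a i)) (\<lambda>i. of_int (b i)) n = (of_int (witt_add p a b n) :: 'a::comm_ring_1)"
proof -
  have "case_sum (\<lambda>i. of_int (a i)) (\<lambda>i. of_int (b i)) = (\<lambda>v. of_int (case_sum a b v) :: 'a)"
    by (auto split: sum.split)
  then show ?thesis
    by (simp add: witt_add_def ieval_of_int)
qed

lemma witt_neg_of_int:
  "witt_neg p (\<lambda>i. of_int (a i)) n = (of_int (witt_neg p a n) :: 'a::comm_ring_1)"
  by (simp add: witt_neg_def ieval_of_int)

lemma witt_mult_of_int:
  "witt_mult p (\<lambda>i. of_int (a i)) (\<lambda>i. of_int (b i)) n = (of_int (witt_mult p a b n) :: 'a::comm_ring_1)"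
proof -
  have "case_sum (\<lambda>i. of_int (a i)) (\<lambda>i. of_int (b i)) = (\<lambda>v. of_int (case_sum a b v) :: 'a)"
    by (auto split: sum.split)
  then show ?thesis
    by (simp add: witt_mult_def ieval_of_int)
qed

text \<open>Taking \<open>p ^ (n - i)\<close>-th powers improves divisibility by \<open>p\<close> to
  divisibility by \<open>p ^ (n - i + 1)\<close>; the weight \<open>p ^ i\<close> supplies the
  remaining factors.\<close>

lemma dvd_ghost_diff:
  fixes x y :: "nat \<Rightarrow> 'a::comm_ring_1"
  assumes "\<And>i. of_nat p dvd x i - y i"
  shows "of_nat p ^ Suc n dvd ghost p x n - ghost p y n"
proof -
  have "of_nat p ^ Suc n dvd
      (\<Sum>i\<le>n. of_nat p ^ i * (x i ^ (p ^ (n - i)) - y i ^ (p ^ (n - i))))"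
  proof (rule dvd_sum)
    fix i assume "i \<in> {..n}"
    then have "(of_nat p :: 'a) ^ Suc n = of_nat p ^ i * of_nat p ^ Suc (n - i)"
      by (simp flip: power_add power_Suc)
    then show "of_nat p ^ Suc n dvd of_nat p ^ i * (x i ^ (p ^ (n - i)) - y i ^ (p ^ (n - i)))"
      using dvd_power_diff_iter[OF assms] by (metis dvd_refl mult_dvd_mono)
  qed
  then show ?thesis
    by (simp only: ghost_def right_diff_distrib sum_subtractf)
qed

section \<open>Witt components as binary digits\<close>

definition binval :: "(nat \<Rightarrow> bit) \<Rightarrow> nat \<Rightarrow> int" where
  "binval a n = (\<Sum>i<n. 2 ^ i * of_bit (a i))"

lemma binval_0 [simp]: "binval a 0 = 0"
  by (simp add: binval_def)

lemma binval_Suc [simp]: "binval a (Suc n) = binval a n + 2 ^ n * of_bit (a n)"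
  by (simp add: binval_def)

lemma binval_bounds: "0 \<le> binval a n \<and> binval a n < 2 ^ n"
  by (induction n) auto

lemma ghost_of_bit: "ghost 2 (\<lambda>i. of_bit (a i)) n = binval a (Suc n)"
  unfolding ghost_def binval_def lessThan_Suc_atMost
  by (intro sum.cong) simp_all

lemma of_int_nth_eq_ghost_div:
  fixes x :: "nat \<Rightarrow> int"
  shows "(of_int (x n) :: bit) = of_int (ghost 2 x n div 2 ^ n)"
proof -
  define c :: "nat \<Rightarrow> bit" where "c = (\<lambda>i. of_int (x i))"
  have "2 ^ Suc n dvd ghost 2 x n - binval c (Suc n)"
    unfolding ghost_of_bit[symmetric]
    using dvd_ghost_diff[of 2 x "\<lambda>i. of_bit (c i)" n] by (simp add: c_def of_int_bit)
  \<comment> \<open>The error is a multiple of \<open>2 ^ (n + 1)\<close>, so after division by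
    \<open>2 ^ n\<close> it is even and disappears in \<open>bit\<close>.\<close>
  then obtain k where "ghost 2 x n = binval c n + (of_bit (c n) + 2 * k) * 2 ^ n"
    by (elim dvdE) (simp add: algebra_simps)
  moreover have "binval c n div 2 ^ n = 0"
    using binval_bounds[of c n] by simp
  ultimately have "ghost 2 x n div 2 ^ n = of_bit (c n) + 2 * k"
    by simp
  then show ?thesis
    by (simp add: c_def of_int_bit)
qed

lemma witt_add_bit:
  "witt_add 2 a b n = of_int ((binval a (Suc n) + binval b (Suc n)) div 2 ^ n)"
  using witt_add_of_int[of 2 "\<lambda>i. of_bit (a i)" "\<lambda>i. of_bit (b i)" n, where 'a = bit]
  by (simp only: of_int_of_bit of_int_nth_eq_ghost_div ghost_witt_add two_is_prime_nat ghost_of_bit)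

lemma witt_neg_bit:
  "witt_neg 2 a n = of_int ((- binval a (Suc n)) div 2 ^ n)"
  using witt_neg_of_int[of 2 "\<lambda>i. of_bit (a i)" n, where 'a = bit]
  by (simp only: of_int_of_bit of_int_nth_eq_ghost_div ghost_witt_neg two_is_prime_nat ghost_of_bit)

lemma witt_mult_bit:
  "witt_mult 2 a b n = of_int ((binval a (Suc n) * binval b (Suc n)) div 2 ^ n)"
  using witt_mult_of_int[of 2 "\<lambda>i. of_bit (a i)" "\<lambda>i. of_bit (b i)" n, where 'a = bit]
  by (simp only: of_int_of_bit of_int_nth_eq_ghost_div ghost_witt_mult two_is_prime_nat ghost_of_bit)

lemma div_add_mult_power2:
  "(x + 2 ^ n * y) div 2 ^ n = x div 2 ^ n + (y :: int)"
  by simp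

lemma div_power2_Suc: "x div 2 ^ Suc n = x div 2 ^ n div (2 :: int)"
  by (simp add: power_Suc2 zdiv_zmult2_eq del: power_Suc)

section \<open>Sum and negative: carries and borrows\<close>

text \<open>A carry is generated at \<open>i\<close> when both digits are 1 and passes through
  \<open>j\<close> when exactly one is. At most one summand is nonzero, because
  \<open>a i * b i = 1\<close> forces \<open>a i + b i = 0\<close>; hence the sum modulo 2 acts as a
  disjunction.\<close>

definition carry :: "(nat \<Rightarrow> bit) \<Rightarrow> (nat \<Rightarrow> bit) \<Rightarrow> nat \<Rightarrow> bit" where
  "carry a b t = (\<Sum>i<t. a i * b i * (\<Prod>j\<in>{i<..<t}. a j + b j))"

text \<open>Full adder: the right-hand side is the majority of \<open>a t\<close>,
  \<open>b t\<close> and the incoming carry.\<close>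

lemma carry_Suc: "carry a b (Suc t) = a t * b t + carry a b t * (a t + b t)"
proof -
  have "{i<..<Suc t} = insert t {i<..<t}" if "i < t" for i
    using that by auto
  moreover have "{t<..<Suc t} = {}"
    by auto
  ultimately show ?thesis
    by (simp add: carry_def sum_distrib_left mult_ac add.commute)
qed

lemma binval_add_Suc_div:
  "(binval a (Suc t) + binval b (Suc t)) div 2 ^ t
    = (binval a t + binval b t) div 2 ^ t + (of_bit (a t) + of_bit (b t))"
proof -
  have "binval a (Suc t) + binval b (Suc t)
      = binval a t + binval b t + 2 ^ t * (of_bit (a t) + of_bit (b t))"
    by (simp add: algebra_simps)
  then show ?thesis
    by (simp only: div_add_mult_power2)
qed

lemma uminus_binval_Suc_div:
  "(- binval a (Suc t)) div 2 ^ t = (- binval a t) div 2 ^ t - of_bit (a t)"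
  using div_add_mult_power2[of "- binval a t" t "- of_bit (a t)"] by simp

lemma binval_add_div: "(binval a t + binval b t) div 2 ^ t = of_bit (carry a b t)"
proof (induction t)
  case 0
  show ?case by (simp add: carry_def)
next
  case (Suc t)
  have "(binval a (Suc t) + binval b (Suc t)) div 2 ^ Suc t
      = (of_bit (carry a b t) + of_bit (a t) + of_bit (b t)) div 2"
    by (simp only: div_power2_Suc binval_add_Suc_div Suc)
  also have "\<dots> = of_bit (carry a b (Suc t))"
    by (cases "a t"; cases "b t"; cases "carry a b t") (simp_all add: carry_Suc)
  finally show ?case .
qed

lemma witt_add_bit_eq_carry: "witt_add 2 a b t = a t + b t + carry a b t"
  by (simp only: witt_add_bit binval_add_Suc_div binval_add_div of_int_add of_int_of_bit ac_simps)

text \<open>Division rounds down, so the quotient is 0 if the first \<open>t\<close> digits all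
  vanish and -1 otherwise; the product is 1 exactly in the former case.\<close>

lemma uminus_binval_div:
  fixes a :: "nat \<Rightarrow> bit"
  shows "(- binval a t) div 2 ^ t = - of_bit (1 + (\<Prod>i<t. 1 + a i))"
proof (induction t)
  case 0
  show ?case by simp
next
  case (Suc t)
  have "(- binval a (Suc t)) div 2 ^ Suc t
      = (- of_bit (1 + (\<Prod>i<t. 1 + a i)) - of_bit (a t)) div 2"
    by (simp only: div_power2_Suc uminus_binval_Suc_div Suc)
  also have "\<dots> = - of_bit (1 + (\<Prod>i<Suc t. 1 + a i))"
    by (cases "a t"; cases "\<Prod>i<t. 1 + a i") simp_all
  finally show ?case .
qed

lemma witt_neg_bit_eq_prod:
  fixes a :: "nat \<Rightarrow> bit"
  shows "witt_neg 2 a t = a t + 1 + (\<Prod>i<t. 1 + a i)"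
  by (simp only: witt_neg_bit uminus_binval_Suc_div uminus_binval_div of_int_diff of_int_minus
      of_int_of_bit) (simp add: ac_simps)

section \<open>Digits as coefficients of powers of 1 + z in characteristic 2\<close>

lemma add_power_two_power_char_2:
  fixes x y :: "'a::comm_ring_1"
  assumes "(2 :: 'a) = 0"
  shows "(x + y) ^ (2 ^ k) = x ^ (2 ^ k) + y ^ (2 ^ k)"
proof (induction k)
  case (Suc k)
  have "(x + y) ^ (2 ^ Suc k) = ((x + y) ^ (2 ^ k))\<^sup>2"
    by (simp add: mult.commute flip: power_mult)
  also have "\<dots> = (x ^ (2 ^ k))\<^sup>2 + (y ^ (2 ^ k))\<^sup>2"
    by (simp add: Suc power2_sum assms)
  finally show ?case
    by (simp add: mult.commute flip: power_mult)
qed simp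

lemma linear_power_two_power:
  assumes "(2 :: 'a::comm_ring_1) = 0"
  shows "[:1, 1 :: 'a:] ^ (2 ^ k) = 1 + monom 1 (2 ^ k)"
proof -
  have "(2 :: 'a poly) = 0"
    using assms by (simp add: numeral_poly)
  moreover have "[:1, 1 :: 'a:] = 1 + monom 1 1"
    by (simp add: monom_altdef one_pCons)
  ultimately show ?thesis
    by (simp add: add_power_two_power_char_2 monom_power)
qed

text \<open>Write N = q * M + r with M = 2^t and r < M. Then (1 + z)^N = (1 + z^M)^q * (1 + z)^r,
  where the last factor has constant term 1 and degree below M.\<close>

lemma coeff_linear_power_two_power:
  assumes "(2 :: 'a::comm_ring_1) = 0"
  shows "coeff ([:1, 1 :: 'a:] ^ N) (2 ^ t) = of_nat (N div 2 ^ t)"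
proof -
  define M R where "M = (2::nat) ^ t" and "R = [:1, 1 :: 'a:] ^ (N mod M)"
  have M: "M > 0" by (simp add: M_def)
  have "degree R \<le> degree [:1, 1 :: 'a:] * (N mod M)"
    unfolding R_def by (rule degree_power_le)
  also have "\<dots> < M"
    using M by simp
  finally have RM: "coeff R M = 0"
    by (rule coeff_eq_0)
  have R0: "coeff R 0 = 1"
    by (simp add: R_def coeff_0_power)
  \<comment> \<open>Each factor 1 + z^M adds the constant coefficient to the one at M, so the
    induction tracks both.\<close>
  have "coeff ((1 + monom 1 M) ^ q * R) 0 = 1 \<and> coeff ((1 + monom 1 M) ^ q * R) M = of_nat q" for q
  proof (induction q)
    case (Suc q)
    have "(1 + monom 1 M) ^ Suc q * R = (1 + monom 1 M) ^ q * R + monom 1 M * ((1 + monom 1 M) ^ q * R)"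
      by (simp add: algebra_simps)
    then show ?case
      using Suc M by (simp add: coeff_monom_mult)
  qed (simp add: R0 RM)
  moreover have "[:1, 1 :: 'a:] ^ N = (1 + monom 1 M) ^ (N div M) * R"
  proof -
    have "[:1, 1 :: 'a:] ^ N = [:1, 1:] ^ (M * (N div M) + N mod M)"
      by simp
    also have "\<dots> = ([:1, 1:] ^ M) ^ (N div M) * R"
      by (simp only: power_add power_mult R_def)
    finally show ?thesis
      by (simp add: M_def linear_power_two_power[OF assms])
  qed
  ultimately show ?thesis
    by (simp add: M_def)
qed

section \<open>Expansion into elementary symmetric polynomials\<close>

lemma prod_monom: "finite A \<Longrightarrow> (\<Prod>i\<in>A. monom (x i) (d i)) = monom (\<Prod>i\<in>A. x i) (\<Sum>i\<in>A. d i)"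
  by (induction A rule: finite_induct) (simp_all add: mult_monom)

text \<open>Expand over the subsets of the \<open>k + 1\<close> factors and group them by
  cardinality.\<close>

lemma prod_one_plus_monom_eq_esym:
  "(\<Prod>i\<le>k. 1 + monom (x i) d) = (\<Sum>l\<le>k + 1. monom (esym l k x) (l * d))"
proof -
  have "(\<Prod>i\<le>k. 1 + monom (x i) d) = (\<Sum>S\<in>Pow {..k}. \<Prod>i\<in>S. monom (x i) d)"
    by (simp add: add.commute[of 1] prod_add)
  also have "\<dots> = (\<Sum>S\<in>Pow {..k}. monom (\<Prod>i\<in>S. x i) (card S * d))"
    by (intro sum.cong) (auto simp: prod_monom finite_subset)
  also have "\<dots> = (\<Sum>l\<le>k + 1. \<Sum>S | S \<in> Pow {..k} \<and> card S = l. monom (\<Prod>i\<in>S. x i) (card S * d))"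
  proof (rule sum.group[symmetric])
    show "card ` Pow {..k} \<subseteq> {..k + 1}"
      using card_mono[of "{..k}"] by force
  qed auto
  also have "\<dots> = (\<Sum>l\<le>k + 1. monom (esym l k x) (l * d))"
    unfolding esym_def monom_sum
    by (intro sum.cong) (auto simp: atLeast0AtMost)
  finally show ?thesis .
qed

lemma L2_eq_PiE:
  "L2 t = {l \<in> PiE {1..t} (\<lambda>k. {..k + 1}). (\<Sum>k=1..t. l k * 2 ^ k) = 2 ^ t}"
  by (auto simp: L2_def PiE_def Pi_def)

text \<open>Choosing the term of index \<open>l k\<close> from the expanded inner product for each
  \<open>k\<close> from 1 to \<open>t\<close> gives total degree
  \<open>\<Sum>k=1..t. l k * 2 ^ k\<close>; \<open>L2 t\<close> collects the choices of degree
  \<open>2 ^ t\<close>.\<close>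

lemma coeff_prod_eq_sum_L2:
  fixes x :: "nat \<Rightarrow> nat \<Rightarrow> 'a::comm_ring_1"
  assumes "t \<ge> 1"
  shows "coeff (\<Prod>k\<le>t. \<Prod>i\<le>k. 1 + monom (x k i) (2 ^ k)) (2 ^ t)
    = (\<Sum>l\<in>L2 t. \<Prod>k=1..t. esym (l k) k (x k))"
proof -
  define F where "F = PiE {1..t} (\<lambda>k. {..k + 1})"
  define Q where "Q = (\<Prod>k=1..t. \<Prod>i\<le>k. 1 + monom (x k i) (2 ^ k))"
  have finF: "finite F"
    unfolding F_def by (intro finite_PiE) auto
  have "Q = (\<Sum>l\<in>F. \<Prod>k=1..t. monom (esym (l k) k (x k)) (l k * 2 ^ k))"
    unfolding Q_def F_def prod_one_plus_monom_eq_esym by (rule prod_sum_PiE) auto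
  also have "\<dots> = (\<Sum>l\<in>F. monom (\<Prod>k=1..t. esym (l k) k (x k)) (\<Sum>k=1..t. l k * 2 ^ k))"
    by (simp add: prod_monom)
  finally have coeff_Q: "coeff Q m
      = (\<Sum>l\<in>F. if (\<Sum>k=1..t. l k * 2 ^ k) = m then \<Prod>k=1..t. esym (l k) k (x k) else 0)" for m
    by (simp add: coeff_sum cong: if_cong)
  \<comment> \<open>The factor for \<open>k = 0\<close> does not contribute, since all exponents occurring in \<open>Q\<close> are even.\<close>
  have "even (\<Sum>k=1..t. l k * 2 ^ k)" for l :: "nat \<Rightarrow> nat"
    by (intro dvd_sum) auto
  moreover have "odd ((2::nat) ^ t - 1)"
    using assms by simp
  ultimately have "(\<Sum>k=1..t. l k * 2 ^ k) \<noteq> 2 ^ t - 1" for l :: "nat \<Rightarrow> nat"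
    by metis
  then have odd_coeff: "coeff Q (2 ^ t - 1) = 0"
    by (simp add: coeff_Q)
  have "{..t} = insert 0 {1..t}"
    by auto
  then have "(\<Prod>k\<le>t. \<Prod>i\<le>k. 1 + monom (x k i) (2 ^ k)) = (1 + monom (x 0 0) 1) * Q"
    by (simp add: Q_def)
  then have "coeff (\<Prod>k\<le>t. \<Prod>i\<le>k. 1 + monom (x k i) (2 ^ k)) (2 ^ t) = coeff Q (2 ^ t)"
    using odd_coeff by (simp add: distrib_right coeff_monom_mult)
  also have "\<dots> = (\<Sum>l\<in>L2 t. \<Prod>k=1..t. esym (l k) k (x k))"
    unfolding L2_eq_PiE coeff_Q F_def[symmetric] using finF by (simp add: sum.inter_filter cong: if_cong)
  finally show ?thesis .
qed

section \<open>Product: truncated binary multiplication\<close>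

text \<open>The product of the two binary numbers without the terms of weight above
  \<open>2 ^ t\<close>; a natural number, since it serves as an exponent.\<close>

definition convval :: "(nat \<Rightarrow> bit) \<Rightarrow> (nat \<Rightarrow> bit) \<Rightarrow> nat \<Rightarrow> nat" where
  "convval a b t = (\<Sum>k\<le>t. \<Sum>i\<le>k. 2 ^ k * of_bit (a i * b (k - i)))"

lemma binval_mult_cong:
  "2 ^ Suc t dvd binval a (Suc t) * binval b (Suc t) - int (convval a b t)"
proof -
  define f :: "nat \<Rightarrow> nat \<Rightarrow> int" where "f = (\<lambda>i j. 2 ^ (i + j) * of_bit (a i * b j))"
  let ?S = "{(i, j). i + j \<le> t}"
  have "binval a (Suc t) * binval b (Suc t) = (\<Sum>i\<le>t. \<Sum>j\<le>t. f i j)"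
    unfolding binval_def lessThan_Suc_atMost sum_product f_def
    by (intro sum.cong refl) (auto simp: power_add)
  also have "\<dots> = (\<Sum>(i, j)\<in>{..t} \<times> {..t}. f i j)"
    by (simp add: sum.cartesian_product)
  also have "\<dots> = (\<Sum>(i, j)\<in>{..t} \<times> {..t} - ?S. f i j) + (\<Sum>(i, j)\<in>?S. f i j)"
    by (rule sum.subset_diff) auto
  also have "(\<Sum>(i, j)\<in>?S. f i j) = int (convval a b t)"
    by (simp add: sum.triangle_reindex_eq convval_def f_def)
  finally have "binval a (Suc t) * binval b (Suc t) - int (convval a b t)
      = (\<Sum>(i, j)\<in>{..t} \<times> {..t} - ?S. f i j)"
    by simp
  \<comment> \<open>Outside the triangle \<open>i + j \<ge> t + 1\<close>, so each discarded term is
    divisible by the modulus.\<close>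
  moreover have "2 ^ Suc t dvd (\<Sum>(i, j)\<in>{..t} \<times> {..t} - ?S. f i j)"
  proof (rule dvd_sum)
    fix z assume "z \<in> {..t} \<times> {..t} - ?S"
    then show "2 ^ Suc t dvd (case z of (i, j) \<Rightarrow> f i j)"
      unfolding f_def by (auto intro!: dvd_mult2 le_imp_power_dvd simp del: power_Suc)
  qed
  ultimately show ?thesis by simp
qed

lemma witt_mult_bit_eq_coeff:
  fixes a b :: "nat \<Rightarrow> bit"
  shows "witt_mult 2 a b t = coeff (\<Prod>k\<le>t. \<Prod>i\<le>k. 1 + monom (a i * b (k - i)) (2 ^ k)) (2 ^ t)"
proof -
  let ?N = "convval a b t"
  obtain k where "binval a (Suc t) * binval b (Suc t) = int ?N + (2 * k) * 2 ^ t"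
    using binval_mult_cong[of t a b] by (elim dvdE) (simp add: algebra_simps)
  then have "binval a (Suc t) * binval b (Suc t) div 2 ^ t = int (?N div 2 ^ t) + 2 * k"
    by (simp add: zdiv_int)
  then have "witt_mult 2 a b t = of_nat (?N div 2 ^ t)"
    by (simp only: witt_mult_bit) simp
  also have "\<dots> = coeff ([:1, 1:] ^ ?N) (2 ^ t)"
    by (simp add: coeff_linear_power_two_power)
  also have "[:1, 1 :: bit:] ^ ?N = (\<Prod>k\<le>t. \<Prod>i\<le>k. ([:1, 1:] ^ (2 ^ k)) ^ of_bit (a i * b (k - i)))"
    by (simp only: convval_def power_sum power_mult)
  also have "\<dots> = (\<Prod>k\<le>t. \<Prod>i\<le>k. 1 + monom (a i * b (k - i)) (2 ^ k))"
  proof (intro prod.cong refl)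
    fix k i
    show "([:1, 1 :: bit:] ^ (2 ^ k)) ^ of_bit (a i * b (k - i)) = 1 + monom (a i * b (k - i)) (2 ^ k)"
      \<comment> \<open>The exponent is 0 or 1, so the power is 1 or 1 + z^(2^k), as on the
        right.\<close>
      by (cases "a i * b (k - i)") (simp_all add: linear_power_two_power)
  qed
  finally show ?thesis .
qed

theorem theorem6p1:
  fixes a b c d e :: "nat \<Rightarrow> bit"
  assumes "c = witt_add 2 a b" and "d = witt_neg 2 a" and "e = witt_mult 2 a b"
  shows "(c 0 = a 0 + b 0 \<and>
      (\<forall>t\<ge>1. c t = a t + b t + (\<Sum>i=0..t-1. a i * b i * (\<Prod>j=i+1..t-1. a j + b j)))) \<and>
    (d 0 = a 0 \<and> (\<forall>t\<ge>1. d t = a t + 1 + (\<Prod>i=0..t-1. 1 + a i))) \<and>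
    (e 0 = a 0 * b 0 \<and>
      (\<forall>t\<ge>1. e t = (\<Sum>l\<in>L2 t. \<Prod>k=1..t. esym (l k) k (\<lambda>i. a i * b (k - i)))))"
proof (intro conjI allI impI)
  show "c 0 = a 0 + b 0"
    by (simp add: assms witt_add_bit_eq_carry carry_def)
  show "d 0 = a 0"
    by (cases "a 0") (simp_all add: assms witt_neg_bit_eq_prod)
  \<comment> \<open>For t = 0 the product is the single factor 1 + a_0 b_0 z, and its coefficient at
    z is read off directly.\<close>
  show "e 0 = a 0 * b 0"
    by (simp add: assms witt_mult_bit_eq_coeff)
next
  fix t :: nat assume t: "t \<ge> 1"
  have set: "{0..t-1} = {..<t}" "{i+1..t-1} = {i<..<t}" for i
    using t by auto
  show "c t = a t + b t + (\<Sum>i=0..t-1. a i * b i * (\<Prod>j=i+1..t-1. a j + b j))"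
    unfolding set by (simp add: assms witt_add_bit_eq_carry carry_def)
  show "d t = a t + 1 + (\<Prod>i=0..t-1. 1 + a i)"
    unfolding set by (simp add: assms witt_neg_bit_eq_prod)
  show "e t = (\<Sum>l\<in>L2 t. \<Prod>k=1..t. esym (l k) k (\<lambda>i. a i * b (k - i)))"
    using coeff_prod_eq_sum_L2[OF t, of "\<lambda>k i. a i * b (k - i)"]
    by (simp add: assms witt_mult_bit_eq_coeff)
qed

end
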